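(* Let $\alpha=(\alpha_1,\dots,\alpha_n)$ be a weak integer composition. The sequence of key polynomials $\{\mathcal{K}_{k\alpha}(\mathbf{x})\}_{k=1}^\infty$ satisfies a linear recurrence with characteristic polynomial $$\prod_{T}\left(t-\mathbf{x}^{w(T)}\right),$$ where the product is taken over all key tableaux $T$ of shape $\lambda(\alpha)$ and basement $\beta(\alpha)$ such that columns of $T$ of equal height have the same filling, and where multiple roots in the product are ignored (i.e. each distinct monomial $\mathbf{x}^{w(T)}$ contributes exactly one factor).
   Context: A weak integer composition is a vector with non-negative integer entries; $k\alpha=(k\alpha_1,\dots,k\alpha_n)$. Rows are drawn left-justified, row 1 at the top. Augmented fillings. Let $\beta=(\beta_1,\dots,\beta_m)$ be a list of distinct positive integers and $\lambda=(\lambda_1\ge\dots\ge\lambda_m)$ a partition. An augmented filling $T$ of shape $\lambda$ and basement $\beta$ is a filling of the boxes $(i,j)$, $1\le i\le m$, $1\le j\le\lambda_i$ ($i$ = row, $j$ = column), with positive integers $T(i,j)$, augmented by a zeroth column (the basement) with $T(i,0)=\beta_i$. Assume the rows (including the basement entry) are weakly decreasing. An inversion triple (type A) is a triple of boxes $a,b,c$ with $a$ immediately to the left of $b$ (possibly $a$ in the basement), $c$ in the same column as $b$ and somewhere below $b$, the row containing $a,b$ at least as long as the row containing $c$ (automatic for partition shapes), and $T(a)\ge T(c)\ge T(b)$. A key tableau of shape $\lambda$ and basement $\beta$ is an augmented filling of shape $\lambda$ and basement $\beta$ with weakly decreasing rows and without inversion triples. (This is a semi-standard augmented filling of partition shape,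 for which only type A triples are relevant.) Weight. $w(T)=(w_1,w_2,\dots,w_n)$, where $w_i$ is the number of boxes of $T$ with content $i$, not including the basement; $\mathbf{x}^{w(T)}=\prod_i x_i^{w_i}$. Columns of a key tableau below are the non-basement columns. From $\alpha$ to $(\beta(\alpha),\lambda(\alpha))$. Draw the left-justified diagram with row lengths $\alpha_1,\dots,\alpha_n$ from top to bottom, and fill its zeroth column from top to bottom with $n,n-1,\dots,1$. Remove all rows with $\alpha_i=0$ and sort the remaining rows (together with their zeroth-column label) by decreasing number of boxes, preserving the relative order of rows of equal length. The resulting row lengths form the partition $\lambda(\alpha)$ and the resulting zeroth column is $\beta(\alpha)$. E.g. $\alpha=(0,2,3,4,2,0,1)$ gives $\beta(\alpha)=(4,5,6,3,1)$ and $\lambda(\alpha)=(4,3,2,2,1)$. Key polynomial. $\mathcal{K}_\alpha(\mathbf{x})=\sum_T \mathbf{x}^{w(T)}$, the sum over all key tableaux $T$ of shape $\lambda(\alpha)$ and basement $\beta(\alpha)$. Linear recurrence. A sequence $\{a_k\}_{k\ge k_0}$ of polynomials satisfies a linear recurrence with characteristic polynomial $\chi(t)=t^r+c_1t^{r-1}+\dots+c_r$ (the $c_i$ being polynomials in $\mathbf{x}$ independent of $k$) if $a_k+c_1a_{k-1}+\dots+c_ra_{k-r}=0$ for all $k\ge k_0+r$. *)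

theory Defs
  imports "HOL-Library.Poly_Mapping" "HOL-Computational_Algebra.Polynomial"
begin

text \<open>
  Boxes are pairs of a row and a column. Rows are counted from \<open>0\<close> (row \<open>i\<close> has length
  \<open>l ! i\<close>); columns are counted from \<open>1\<close>, and column \<open>0\<close> is the basement.
\<close>

definition boxes :: "nat list \<Rightarrow> (nat \<times> nat) set" where
  "boxes l = {(i, j). i < length l \<and> 1 \<le> j \<and> j \<le> l ! i}"

text \<open>
  A filling is a total function on positions. Requiring the value \<open>0\<close> outside the augmented
  diagram makes two fillings equal iff they agree on the diagram; no box contains \<open>0\<close>.
\<close>

definition augmented_filling :: "nat list \<Rightarrow> nat list \<Rightarrow> (nat \<Rightarrow> nat \<Rightarrow> nat) \<Rightarrow> bool" where
  "augmented_filling b l T \<longleftrightarrow>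
     length b = length l \<and> distinct b \<and> (\<forall>v\<in>set b. 0 < v) \<and>
     sorted_wrt (\<ge>) l \<and>
     (\<forall>i < length l. T i 0 = b ! i) \<and>
     (\<forall>(i, j)\<in>boxes l. 0 < T i j) \<and>
     (\<forall>i j. (i, j) \<notin> boxes l \<and> \<not> (i < length l \<and> j = 0) \<longrightarrow> T i j = 0)"

definition rows_weakly_decreasing :: "nat list \<Rightarrow> (nat \<Rightarrow> nat \<Rightarrow> nat) \<Rightarrow> bool" where
  "rows_weakly_decreasing l T \<longleftrightarrow> (\<forall>(i, j)\<in>boxes l. T i j \<le> T i (j - 1))"

definition inversion_triple ::
    "nat list \<Rightarrow> (nat \<Rightarrow> nat \<Rightarrow> nat) \<Rightarrow> nat \<times> nat \<Rightarrow> nat \<times> nat \<Rightarrow> nat \<times> nat \<Rightarrow> bool" where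
  "inversion_triple l T a b c \<longleftrightarrow>
     b \<in> boxes l \<and> c \<in> boxes l \<and>
     fst a = fst b \<and> Suc (snd a) = snd b \<and>
     snd c = snd b \<and> fst b < fst c \<and>
     l ! fst c \<le> l ! fst b \<and>
     T (fst b) (snd b) \<le> T (fst c) (snd c) \<and> T (fst c) (snd c) \<le> T (fst a) (snd a)"

definition key_tableau :: "nat list \<Rightarrow> nat list \<Rightarrow> (nat \<Rightarrow> nat \<Rightarrow> nat) \<Rightarrow> bool" where
  "key_tableau b l T \<longleftrightarrow>
     augmented_filling b l T \<and> rows_weakly_decreasing l T \<and>
     (\<nexists>a b c. inversion_triple l T a b c)"

definition column :: "nat list \<Rightarrow> (nat \<Rightarrow> nat \<Rightarrow> nat) \<Rightarrow> nat \<Rightarrow> nat list" where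
  "column l T j = map (\<lambda>i. T i j) (filter (\<lambda>i. (i, j) \<in> boxes l) [0..<length l])"

definition equal_height_columns_agree :: "nat list \<Rightarrow> (nat \<Rightarrow> nat \<Rightarrow> nat) \<Rightarrow> bool" where
  "equal_height_columns_agree l T \<longleftrightarrow>
     (\<forall>j\<ge>1. \<forall>j'\<ge>1. length (column l T j) = length (column l T j') \<longrightarrow>
        column l T j = column l T j')"

text \<open>
  Polynomials are finitely supported maps from exponent vectors to integer coefficients, with
  the convolution product.
\<close>

type_synonym mpoly = "(nat \<Rightarrow>\<^sub>0 nat) \<Rightarrow>\<^sub>0 int"

definition Var :: "nat \<Rightarrow> mpoly" where
  "Var i = Poly_Mapping.single (Poly_Mapping.single i 1) 1"

definition weight :: "nat list \<Rightarrow> (nat \<Rightarrow> nat \<Rightarrow> nat) \<Rightarrow> nat \<Rightarrow> nat" where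
  "weight l T v = card {(i, j) \<in> boxes l. T i j = v}"

definition weight_monom :: "nat \<Rightarrow> nat list \<Rightarrow> (nat \<Rightarrow> nat \<Rightarrow> nat) \<Rightarrow> mpoly" where
  "weight_monom n l T = (\<Prod>i = 1..n. Var i ^ weight l T i)"

text \<open>
  A weak composition is a list of naturals. Each nonempty row is paired with its label
  \<open>n, n - 1, \<dots>, 1\<close>; \<^const>\<open>sort_key\<close> is stable, and negating the key sorts by
  decreasing row length.
\<close>

definition sorted_rows :: "nat list \<Rightarrow> (nat \<times> nat) list" where
  "sorted_rows \<alpha> =
     sort_key (\<lambda>(len, lab). - int len)
       (filter (\<lambda>(len, lab). len \<noteq> 0) (zip \<alpha> (rev [1..<Suc (length \<alpha>)])))"

definition shape_of :: "nat list \<Rightarrow> nat list" where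
  "shape_of \<alpha> = map fst (sorted_rows \<alpha>)"

definition basement_of :: "nat list \<Rightarrow> nat list" where
  "basement_of \<alpha> = map snd (sorted_rows \<alpha>)"

lemma "basement_of [0,2,3,4,2,0,1] = [4,5,6,3,1]" "shape_of [0,2,3,4,2,0,1] = [4,3,2,2,1]"
  by code_simp+

definition scale_comp :: "nat \<Rightarrow> nat list \<Rightarrow> nat list" where
  "scale_comp k \<alpha> = map (\<lambda>a. k * a) \<alpha>"

definition key_poly :: "nat list \<Rightarrow> mpoly" where
  "key_poly \<alpha> =
     (\<Sum>T | key_tableau (basement_of \<alpha>) (shape_of \<alpha>) T.
        weight_monom (length \<alpha>) (shape_of \<alpha>) T)"

definition satisfies_linear_recurrence ::
    "(nat \<Rightarrow> 'a::comm_ring_1) \<Rightarrow> nat \<Rightarrow> 'a poly \<Rightarrow> bool" where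
  "satisfies_linear_recurrence a k0 \<chi> \<longleftrightarrow>
     lead_coeff \<chi> = 1 \<and>
     (\<forall>k \<ge> k0 + degree \<chi>. (\<Sum>i = 0..degree \<chi>. coeff \<chi> (degree \<chi> - i) * a (k - i)) = 0)"

text \<open>
  The following facts show that the sum defining \<^const>\<open>key_poly\<close> is over a finite set, and
  that its basement and shape meet the requirements of \<^const>\<open>augmented_filling\<close>.
\<close>

lemma key_tableau_le_basement:
  assumes "key_tableau b l T" "i < length l" "j \<le> l ! i"
  shows "T i j \<le> b ! i"
  using assms(3)
proof (induction j)
  case 0
  then show ?case using assms by (simp add: key_tableau_def augmented_filling_def)
next
  case (Suc j)
  have "(i, Suc j) \<in> boxes l" using Suc assms by (simp add: boxes_def)
  then have "T i (Suc j) \<le> T i j"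
    using assms(1) by (fastforce simp: key_tableau_def rows_weakly_decreasing_def)
  then show ?case using Suc by simp
qed

lemma finite_key_tableaux: "finite {T. key_tableau b l T}"
proof -
  define D where "D = Sigma {..<length l} (\<lambda>i. {..l ! i})"
  define S where "S = {f. \<forall>p. (p \<in> D \<longrightarrow> f p \<in> {..Max (set b)}) \<and> (p \<notin> D \<longrightarrow> f p = (0::nat))}"
  have "finite S"
    unfolding S_def by (rule finite_set_of_finite_funs) (auto simp: D_def)
  moreover have "{T. key_tableau b l T} \<subseteq> curry ` S"
  proof
    fix T assume "T \<in> {T. key_tableau b l T}"
    then have T: "key_tableau b l T" by simp
    then have len: "length b = length l" by (simp add: key_tableau_def augmented_filling_def)
    have "T i j \<le> Max (set b)" if "(i, j) \<in> D" for i j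
    proof -
      have "T i j \<le> b ! i" using key_tableau_le_basement[OF T] that by (auto simp: D_def)
      also have "\<dots> \<le> Max (set b)" using that len by (auto simp: D_def)
      finally show ?thesis .
    qed
    moreover have "T i j = 0" if "(i, j) \<notin> D" for i j
    proof -
      have "(i, j) \<notin> boxes l \<and> \<not> (i < length l \<and> j = 0)"
        using that by (auto simp: D_def boxes_def)
      then show ?thesis using T unfolding key_tableau_def augmented_filling_def by blast
    qed
    ultimately have "case_prod T \<in> S" by (auto simp: S_def)
    then show "T \<in> curry ` S" by (metis curry_case_prod image_eqI)
  qed
  ultimately show ?thesis by (meson finite_imageI finite_subset)
qed

lemma sorted_shape_of: "sorted_wrt (\<ge>) (shape_of \<alpha>)"
proof -
  have "sorted (map (\<lambda>(len, lab). - int len) (sorted_rows \<alpha>))"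
    unfolding sorted_rows_def by (rule sorted_sort_key)
  then show ?thesis
    by (simp add: shape_of_def sorted_wrt_map case_prod_beta)
qed

lemma basement_of_wf:
  "length (basement_of \<alpha>) = length (shape_of \<alpha>)"
  "distinct (basement_of \<alpha>)"
  "v \<in> set (basement_of \<alpha>) \<Longrightarrow> 0 < v \<and> v \<le> length \<alpha>"
proof -
  let ?z = "zip \<alpha> (rev [1..<Suc (length \<alpha>)])"
  show "length (basement_of \<alpha>) = length (shape_of \<alpha>)"
    by (simp add: basement_of_def shape_of_def)
  have map: "map snd ?z = rev [1..<Suc (length \<alpha>)]"
    by (simp del: upt_Suc)
  then have "distinct (map snd ?z)" by (simp del: upt_Suc)
  then have d: "distinct (map snd (filter (\<lambda>(len, lab). len \<noteq> 0) ?z))"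
    by (rule distinct_map_filter)
  then show "distinct (basement_of \<alpha>)"
    unfolding basement_of_def sorted_rows_def distinct_map
    by (simp del: upt_Suc)
  assume "v \<in> set (basement_of \<alpha>)"
  then have "v \<in> set (map snd ?z)"
    by (auto simp: basement_of_def sorted_rows_def simp del: upt_Suc map_snd_zip)
  then show "0 < v \<and> v \<le> length \<alpha>" unfolding map by auto
qed

end

theory Submission
  imports Defs "HOL-Computational_Algebra.Polynomial_Factorial"
begin

text \<open>
  A key tableau is a walk on columns: whether a column may follow another depends on these two only,
  and a column may always follow itself. Besides such loops, a step between columns of equal height
  decreases the entry sum, so it changes the monomial. Hence, over the fraction field, the sum over
  walks inside one block of equal heights is a linear combination of the pure powers
  \<open>y\<^sub>D\<^sup>n\<close> of the column monomials, without polynomial factors in \<open>n\<close>, and the sum over all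
  tableaux is a combination of powers \<open>\<mu>\<^sup>k\<close>, where \<open>\<mu>\<close> is obtained by picking one visited column
  for each height.

  It remains to see that the picked columns have the contents of the columns of an actual key tableau,
  although the step relation is not transitive: \<open>(1,2)\<close> may follow \<open>(1,3)\<close>, which may follow
  \<open>(2,3)\<close>, but of the columns with content \<open>{1,2}\<close> only \<open>(2,1)\<close> may
  follow \<open>(2,3)\<close>. The column with given content following \<open>C\<close> is found greedily, and comparing the contents of all prefixes of columns in the Gale order (as in the
  tableau criterion for the Bruhat order) shows that skipping columns leaves every later content
  reachable.
\<close>

subsection \<open>Steps between columns\<close>

text \<open>The condition of a key tableau on two adjacent columns: \<open>D\<close> occupies the
  top rows of \<open>C\<close>, and the last clause excludes inversion triples.\<close>

definition next_column :: "nat list \<Rightarrow> nat list \<Rightarrow> bool" where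
  "next_column C D \<longleftrightarrow> length D \<le> length C \<and> 0 \<notin> set D \<and> (\<forall>i<length D. D ! i \<le> C ! i) \<and>
     (\<forall>i j. i < j \<and> j < length D \<longrightarrow> \<not> (D ! i \<le> D ! j \<and> D ! j \<le> C ! i))"

text \<open>Counting the entries from each threshold \<open>t\<close> on expresses, without sorting,
  that the first \<open>p\<close> entries of \<open>D\<close> lie below those of \<open>C\<close> in
  the Gale order.\<close>

definition prefix_dominates :: "nat list \<Rightarrow> nat list \<Rightarrow> bool" where
  "prefix_dominates C D \<longleftrightarrow> length D \<le> length C \<and>
     (\<forall>p\<le>length D. \<forall>t. length (filter ((\<le>) t) (take p D)) \<le> length (filter ((\<le>) t) (take p C)))"

text \<open>
  Think of \<open>S\<close> as parking spots: the car \<open>C ! i\<close> takes the largest free spot not above it.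
\<close>

definition greedy :: "nat set \<Rightarrow> nat list \<Rightarrow> nat list \<Rightarrow> bool" where
  "greedy S C D \<longleftrightarrow> length D \<le> length C \<and> distinct D \<and> set D \<subseteq> S \<and>
     (\<forall>i<length D. D ! i \<le> C ! i \<and> (\<forall>s\<in>S. D ! i < s \<and> s \<le> C ! i \<longrightarrow> s \<in> set (take i D)))"

text \<open>Two equal entries would form an inversion triple with the left neighbour of the upper
  one.\<close>

lemma next_column_distinct:
  assumes "next_column C D" shows "distinct D"
proof -
  have "D ! i \<noteq> D ! j" if "i < j" "j < length D" for i j
  proof -
    have "D ! i \<le> C ! i" "\<not> (D ! i \<le> D ! j \<and> D ! j \<le> C ! i)"
      using assms that by (auto simp: next_column_def)
    then show ?thesis by auto
  qed
  then show ?thesis unfolding distinct_conv_nth nat_neq_iff by metis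
qed

text \<open>From \<open>D\<close> to itself an inversion triple would force two equal entries, and
  the entries of \<open>D\<close> are distinct.\<close>

lemma next_column_self:
  assumes "next_column C D" shows "next_column D D"
proof -
  have "D ! i \<noteq> D ! j" if "i < j" "j < length D" for i j
    using next_column_distinct[OF assms] that nth_eq_iff_index_eq[of D i j] by simp
  then show ?thesis using assms by (fastforce simp: next_column_def)
qed

lemma filter_length_mono:
  assumes "length D = length C" "\<And>i. i < length D \<Longrightarrow> D ! i \<le> (C ! i :: nat)"
  shows "length (filter ((\<le>) t) D) \<le> length (filter ((\<le>) t) C)"
  unfolding length_filter_conv_card
  using assms by (intro card_mono) (auto intro: order_trans)

lemma next_column_prefix_dominates:
  assumes "next_column C D" shows "prefix_dominates C D"
proof -
  have "length (filter ((\<le>) t) (take p D)) \<le> length (filter ((\<le>) t) (take p C))"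
    if "p \<le> length D" for p t
    using assms that by (intro filter_length_mono) (auto simp: next_column_def)
  then show ?thesis using assms by (simp add: prefix_dominates_def next_column_def)
qed

text \<open>Dominance is the transitive relation that stands in for the non-transitive
  \<open>next_column\<close>.\<close>

lemma prefix_dominates_trans:
  "prefix_dominates A B \<Longrightarrow> prefix_dominates B C \<Longrightarrow> prefix_dominates A C"
  unfolding prefix_dominates_def by (meson order_trans)

section \<open>Extremality of greedy columns\<close>

lemma greedy_take: "greedy S C D \<Longrightarrow> p \<le> length D \<Longrightarrow> greedy S C (take p D)"
  unfolding greedy_def
  by (auto simp: min_def dest: in_set_takeD)

text \<open>A car with \<open>D ! i < x \<le> C ! i\<close> would have preferred the free spot
  \<open>x\<close>. Hence each entry lies on the same side of \<open>x\<close> as its car.\<close>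

lemma greedy_gap:
  assumes g: "greedy S C D" and x: "x \<in> S" "x \<notin> set D"
  shows "length (filter ((\<le>) x) D) = length (filter ((\<le>) x) (take (length D) C))"
proof -
  have "x \<le> D ! i \<longleftrightarrow> x \<le> C ! i" if "i < length D" for i
    using g x that unfolding greedy_def by (meson in_set_takeD not_le order_trans)
  moreover have "length D \<le> length C" using g by (simp add: greedy_def)
  ultimately show ?thesis
    unfolding length_filter_conv_card by (intro arg_cong[where f = card]) auto
qed

lemma filter_length_le:
  assumes "distinct E" "distinct D" "\<And>s. s \<in> set E \<Longrightarrow> P s \<Longrightarrow> s \<in> set D"
  shows "length (filter P E) \<le> length (filter P D)"
proof -
  have "card (set (filter P E)) \<le> card (set (filter P D))"
    using assms(3) by (intro card_mono) auto
  then show ?thesis using assms(1,2) by (simp add: distinct_card del: set_filter)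
qed

lemma filter_length_split:
  fixes t x :: nat
  assumes "t \<le> x"
  shows "length (filter ((\<le>) t) D) =
    length (filter ((\<le>) x) D) + length (filter (\<lambda>s. t \<le> s \<and> s < x) D)"
  using assms by (induction D) auto

text \<open>
  If \<open>x\<close> is the least free spot from \<open>t\<close> on, then all spots in \<open>[t, x)\<close> are taken, and every car
  from \<open>x\<close> on has parked from \<open>x\<close> on; both counts are as large as possible.
\<close>

lemma greedy_maximal:
  assumes g: "greedy S C D" and E: "distinct E" "set E \<subseteq> S"
    and dom: "\<And>t. length (filter ((\<le>) t) E) \<le> length (filter ((\<le>) t) (take (length D) C))"
    and fin: "finite S"
  shows "length (filter ((\<le>) t) E) \<le> length (filter ((\<le>) t) D)"
proof (cases "\<exists>s\<in>S - set D. t \<le> s")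
  case True
  define F where "F = {s \<in> S - set D. t \<le> s}"
  have F: "finite F" "F \<noteq> {}" using fin True by (auto simp: F_def)
  define x where "x = Min F"
  have x: "x \<in> S" "x \<notin> set D" "t \<le> x" using Min_in[OF F] by (auto simp: F_def x_def)
  have min: "s \<in> set D" if "s \<in> S" "t \<le> s" "s < x" for s
    using Min_le[OF F(1), of s] that by (force simp: F_def x_def)
  have "length (filter (\<lambda>s. t \<le> s \<and> s < x) E) \<le> length (filter (\<lambda>s. t \<le> s \<and> s < x) D)"
    using E g min by (intro filter_length_le) (auto simp: greedy_def)
  moreover have "length (filter ((\<le>) x) E) \<le> length (filter ((\<le>) x) D)"
    using dom[of x] greedy_gap[OF g x(1,2)] by simp
  ultimately show ?thesis
    using filter_length_split[OF x(3), of E] filter_length_split[OF x(3), of D] by simp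
next
  case False
  then show ?thesis using E g by (intro filter_length_le) (auto simp: greedy_def)
qed

text \<open>If the next car found no spot, the least free spot \<open>x\<close> would exceed it. All
  spots below \<open>x\<close> are then taken, and the entries from \<open>x\<close> on are bounded
  by dominance, so the first \<open>length D + 1\<close> entries of \<open>E\<close> would number at
  most \<open>length D\<close>.\<close>

lemma greedy_step:
  assumes g: "greedy S C D" and E: "distinct E" "set E = S" and dom: "prefix_dominates C E"
    and less: "length D < length E"
  shows "\<exists>s\<in>S - set D. s \<le> C ! length D"
proof (rule ccontr)
  let ?p = "length D"
  assume "\<not> ?thesis"
  then have occ: "s \<in> set D" if "s \<in> S" "s \<le> C ! ?p" for s using that by blast
  have fin: "finite S" using E by auto
  have "card S = length E" "card (set D) = length D"
    using E g by (auto simp: distinct_card greedy_def)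
  then have ne: "S - set D \<noteq> {}"
    by (metis Diff_eq_empty_iff List.finite_set card_mono less not_le)
  define x where "x = Min (S - set D)"
  have x: "x \<in> S" "x \<notin> set D" using Min_in[OF _ ne] fin by (auto simp: x_def)
  have min: "s \<in> set D" if "s \<in> S" "s < x" for s
    using that fin by (metis DiffI finite_Diff leD x_def Min_le)
  have Cx: "C ! ?p < x" using occ x by force
  have lenC: "?p < length C" using less dom by (simp add: prefix_dominates_def)
  have "length (filter (\<lambda>s. \<not> x \<le> s) (take (Suc ?p) E)) \<le> length (filter (\<lambda>s. \<not> x \<le> s) D)"
    using E g min by (intro filter_length_le) (auto simp: greedy_def dest: in_set_takeD)
  moreover have "length (filter ((\<le>) x) (take (Suc ?p) E)) \<le> length (filter ((\<le>) x) (take (Suc ?p) C))"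
    using dom less by (simp add: prefix_dominates_def)
  \<comment> \<open>The next car lies below \<open>x\<close>, so it adds nothing to the count of
    cars from \<open>x\<close> on.\<close>
  moreover have "length (filter ((\<le>) x) (take (Suc ?p) C)) = length (filter ((\<le>) x) D)"
    using Cx lenC greedy_gap[OF g x] by (simp add: take_Suc_conv_app_nth)
  moreover have "length (filter ((\<le>) x) (take (Suc ?p) E)) + length (filter (\<lambda>s. \<not> x \<le> s) (take (Suc ?p) E))
      = Suc ?p"
    using sum_length_filter_compl[of "(\<le>) x" "take (Suc ?p) E"] less by simp
  moreover have "length (filter ((\<le>) x) D) + length (filter (\<lambda>s. \<not> x \<le> s) D) = ?p"
    using sum_length_filter_compl[of "(\<le>) x" D] by simp
  ultimately show False by linarith
qed

lemma greedy_exists: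
  assumes E: "distinct E" and dom: "prefix_dominates C E" and "q \<le> length E"
  shows "\<exists>D. length D = q \<and> greedy (set E) C D"
  using assms(3)
proof (induction q)
  case 0
  then show ?case by (intro exI[of _ "[]"]) (simp add: greedy_def)
next
  case (Suc q)
  then obtain D where D: "length D = q" "greedy (set E) C D" by auto
  \<comment> \<open>The next car takes the largest of these spots; \<open>greedy_step\<close>
    provides one.\<close>
  define F where "F = {s \<in> set E - set D. s \<le> C ! q}"
  have F: "finite F" "F \<noteq> {}"
    using greedy_step[OF D(2) E refl dom] Suc.prems D(1) by (auto simp: F_def)
  define x where "x = Max F"
  have x: "x \<in> set E" "x \<notin> set D" "x \<le> C ! q" using Max_in[OF F] by (auto simp: F_def x_def)
  have max: "s \<in> set D" if "s \<in> set E" "x < s" "s \<le> C ! q" for s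
  proof (rule ccontr)
    assume "s \<notin> set D"
    then have "s \<in> F" using that by (simp add: F_def)
    then show False using Max_ge[OF F(1)] that by (simp add: x_def leD)
  qed
  have "greedy (set E) C (D @ [x])"
    unfolding greedy_def
  proof (intro conjI allI impI)
    show "length (D @ [x]) \<le> length C"
      using Suc.prems D dom by (simp add: prefix_dominates_def)
    show "distinct (D @ [x])" "set (D @ [x]) \<subseteq> set E" using x D by (auto simp: greedy_def)
    fix i assume "i < length (D @ [x])"
    then consider "i < q" | "i = q" using D by force
    then show "(D @ [x]) ! i \<le> C ! i"
      "\<forall>s\<in>set E. (D @ [x]) ! i < s \<and> s \<le> C ! i \<longrightarrow> s \<in> set (take i (D @ [x]))"
      using D x max by (cases; force simp: greedy_def nth_append)+
  qed
  then show ?case using D by (intro exI[of _ "D @ [x]"]) simp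
qed

text \<open>\<open>D\<close> is obtained by parking the cars of \<open>C\<close> greedily on the
  spots \<open>set D'\<close>. It uses all of them by counting, greediness excludes inversion
  triples, and maximality of each greedy prefix gives the dominance over \<open>D'\<close> with
  which the next step can be treated.\<close>

lemma next_column_dominating:
  assumes dom: "prefix_dominates C C'" and next': "next_column C' D'"
  obtains D where "set D = set D'" "length D = length D'" "next_column C D" "prefix_dominates D D'"
proof -
  have d': "distinct D'" using next' by (rule next_column_distinct)
  have CD': "prefix_dominates C D'"
    using dom next_column_prefix_dominates[OF next'] by (rule prefix_dominates_trans)
  obtain D where D: "length D = length D'" "greedy (set D') C D"
    using greedy_exists[OF d' CD'] by blast
  have sets: "set D = set D'"
    using D d' by (intro card_subset_eq) (auto simp: greedy_def distinct_card)
  have "next_column C D"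
    unfolding next_column_def
  proof (intro conjI allI impI notI)
    show "length D \<le> length C" using D by (simp add: greedy_def)
    show "0 \<in> set D \<Longrightarrow> False" using sets next' by (simp add: next_column_def)
    show "D ! i \<le> C ! i" if "i < length D" for i using D that by (simp add: greedy_def)
    \<comment> \<open>The spot \<open>D ! j\<close> lies above \<open>D ! i\<close> and not above
      \<open>C ! i\<close>, so car \<open>i\<close> passed it over only because an earlier car had
      it; but \<open>D\<close> has no repetition.\<close>
    fix i j assume ij: "i < j \<and> j < length D" and inv: "D ! i \<le> D ! j \<and> D ! j \<le> C ! i"
    have dist: "distinct D" using D by (simp add: greedy_def)
    then have "D ! i \<noteq> D ! j" using ij nth_eq_iff_index_eq[of D i j] by simp
    then have "D ! i < D ! j" using inv by simp
    moreover have "D ! j \<in> set D'" using ij nth_mem[of j D] sets by simp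
    ultimately have "D ! j \<in> set (take i D)"
      using D(2) ij inv unfolding greedy_def by (meson order.strict_trans)
    then obtain k where "k < i" "D ! k = D ! j" using ij by (auto simp: in_set_conv_nth)
    then show False using ij nth_eq_iff_index_eq[OF dist, of k j] by simp
  qed
  moreover have "prefix_dominates D D'"
    unfolding prefix_dominates_def
  proof (intro conjI allI impI)
    fix p t assume p: "p \<le> length D'"
    have "greedy (set D') C (take p D)" using greedy_take[OF D(2)] p D by simp
    then show "length (filter ((\<le>) t) (take p D')) \<le> length (filter ((\<le>) t) (take p D))"
    proof (rule greedy_maximal)
      show "length (filter ((\<le>) t) (take p D')) \<le>
          length (filter ((\<le>) t) (take (length (take p D)) C))" for t
        using CD' p D(1) by (simp add: prefix_dominates_def)
      show "set (take p D') \<subseteq> set D'" by (rule set_take_subset)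
    qed (use d' in simp_all)
  qed (use D(1) in simp)
  ultimately show ?thesis by (rule that[OF sets D(1)])
qed

subsection \<open>Linear combinations of power sequences\<close>

text \<open>The linear span of \<open>B\<close>, generated one summand at a time so that linear
  statements follow by induction.\<close>

inductive spanned :: "('p \<Rightarrow> 'b::field) set \<Rightarrow> ('p \<Rightarrow> 'b) \<Rightarrow> bool" for B where
  zero: "spanned B (\<lambda>_. 0)"
| add_basis: "b \<in> B \<Longrightarrow> spanned B f \<Longrightarrow> spanned B (\<lambda>p. c * b p + f p)"

lemma spanned_basis: "b \<in> B \<Longrightarrow> spanned B b"
  using spanned.add_basis[of b B "\<lambda>_. 0" 1] spanned.zero[of B] by simp

lemma spanned_add: "spanned B f \<Longrightarrow> spanned B g \<Longrightarrow> spanned B (\<lambda>p. f p + g p)"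
  by (induction f rule: spanned.induct) (auto simp: add.assoc intro: spanned.add_basis)

lemma spanned_scale: "spanned B f \<Longrightarrow> spanned B (\<lambda>p. a * f p)"
proof (induction f rule: spanned.induct)
  case (add_basis b f c)
  then show ?case
    using spanned.add_basis[of b B "\<lambda>p. a * f p" "a * c"] by (simp add: algebra_simps)
qed (simp add: spanned.zero)

lemma spanned_sum:
  "(\<And>i. i \<in> I \<Longrightarrow> spanned B (f i)) \<Longrightarrow> spanned B (\<lambda>p. \<Sum>i\<in>I. f i p)"
proof (induction I rule: infinite_finite_induct)
  case (insert i I)
  then show ?case by (simp add: spanned_add)
qed (simp_all add: spanned.zero)

text \<open>Reindexing by \<open>\<sigma>\<close> and multiplying by \<open>u\<close> are linear, so
  it suffices to control the generators. Instances are enlarging the generating set, evaluating at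
  \<open>n = 0\<close> and substituting for \<open>n\<close>.\<close>

lemma spanned_linear_image:
  assumes "spanned B f"
    and "\<And>b. b \<in> B \<Longrightarrow> spanned B' (\<lambda>p. u p * b (\<sigma> p))"
  shows "spanned B' (\<lambda>p. u p * f (\<sigma> p))"
  using assms(1)
proof (induction f rule: spanned.induct)
  case (add_basis b f c)
  have "spanned B' (\<lambda>p. c * (u p * b (\<sigma> p)) + u p * f (\<sigma> p))"
    using add_basis assms(2) by (intro spanned_add spanned_scale)
  then show ?case by (simp add: algebra_simps)
qed (simp add: spanned.zero)

lemma spanned_mono: "spanned B f \<Longrightarrow> B \<subseteq> B' \<Longrightarrow> spanned B' f"
  using spanned_linear_image[of B f B' "\<lambda>_. 1" "\<lambda>p. p"] by (auto intro: spanned_basis)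

text \<open>The index is shifted by one because the recurrence starts at \<open>k = 1\<close>.\<close>

definition power_seq :: "'b::field \<Rightarrow> nat \<Rightarrow> 'b" where
  "power_seq \<mu> k = \<mu> ^ Suc k"

text \<open>\<open>n\<close> counts the steps left in the current block, with column monomial
  \<open>e\<close>; \<open>\<mu>\<close> collects the later blocks, which are scaled by
  \<open>Suc k\<close>.\<close>

definition power_seq2 :: "'b::field \<times> 'b \<Rightarrow> nat \<times> nat \<Rightarrow> 'b" where
  "power_seq2 = (\<lambda>(e, \<mu>) (n, k). e ^ n * \<mu> ^ Suc k)"

text \<open>The forcing term \<open>e ^ n * \<mu> ^ Suc k\<close> is not resonant as
  \<open>e \<noteq> y\<close>, so dividing it by \<open>e - y\<close> solves the recursion;
  solutions add up.\<close>

lemma particular_solution: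
  assumes "spanned (power_seq2 ` X) r" and "\<And>e \<mu>. (e, \<mu>) \<in> X \<Longrightarrow> e \<noteq> y"
  shows "\<exists>q. spanned (power_seq2 ` X) q \<and> (\<forall>n k. q (Suc n, k) = y * q (n, k) + r (n, k))"
  using assms(1)
proof (induction r rule: spanned.induct)
  case zero
  show ?case by (intro exI[of _ "\<lambda>_. 0"]) (simp add: spanned.zero)
next
  case (add_basis b r c)
  then obtain q e \<mu> where q: "spanned (power_seq2 ` X) q" "\<And>n k. q (Suc n, k) = y * q (n, k) + r (n, k)"
    and b: "b = power_seq2 (e, \<mu>)" and X: "(e, \<mu>) \<in> X" by auto
  have ne: "e - y \<noteq> 0" using assms(2) X by auto
  show ?case
  proof (intro exI conjI allI)
    show "spanned (power_seq2 ` X) (\<lambda>p. c / (e - y) * b p + q p)"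
      using q add_basis.hyps(1) by (intro spanned.add_basis)
    fix n k
    have "c / (e - y) * (e ^ Suc n * \<mu> ^ Suc k) =
        y * (c / (e - y) * (e ^ n * \<mu> ^ Suc k)) + c * (e ^ n * \<mu> ^ Suc k)"
      using ne by (simp add: field_simps)
    then show "c / (e - y) * b (Suc n, k) + q (Suc n, k) =
        y * (c / (e - y) * b (n, k) + q (n, k)) + (c * b (n, k) + r (n, k))"
      by (simp add: q b power_seq2_def algebra_simps)
  qed
qed

text \<open>The difference from a particular solution solves the homogeneous recursion, so it is
  \<open>y ^ n\<close> times its value at \<open>n = 0\<close>, which is a combination of power
  sequences of elements of \<open>M\<close>.\<close>

lemma spanned_recursion:
  assumes r: "spanned (power_seq2 ` X) r" and X: "\<And>e \<mu>. (e, \<mu>) \<in> X \<Longrightarrow> e \<noteq> y \<and> \<mu> \<in> M"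
    and f0: "spanned (power_seq ` M) (\<lambda>k. f (0, k))"
    and f: "\<And>n k. f (Suc n, k) = y * f (n, k) + r (n, k)"
  shows "spanned (power_seq2 ` (X \<union> {y} \<times> M)) f"
proof -
  obtain q where q: "spanned (power_seq2 ` X) q" "\<And>n k. q (Suc n, k) = y * q (n, k) + r (n, k)"
    using particular_solution[OF r] X by blast
  have "f (n, k) - q (n, k) = y ^ n * (f (0, k) - q (0, k))" for n k
  proof (induction n)
    case (Suc n)
    have "f (Suc n, k) - q (Suc n, k) = y * (f (n, k) - q (n, k))"
      by (simp add: f q algebra_simps)
    then show ?case by (simp add: Suc)
  qed simp
  then have fq: "f = (\<lambda>p. q p + y ^ fst p * (f (0, snd p) + (- 1) * q (0, snd p)))"
    by (auto simp: fun_eq_iff algebra_simps)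
  have "spanned (power_seq ` M) (\<lambda>k. 1 * q (0, k))"
    using q(1) by (rule spanned_linear_image)
      (use X in \<open>auto simp: power_seq2_def power_seq_def[abs_def] intro!: spanned_basis\<close>)
  then have "spanned (power_seq ` M) (\<lambda>k. f (0, k) + (- 1) * q (0, k))"
    using f0 by (intro spanned_add spanned_scale) simp_all
  then have "spanned (power_seq2 ` ({y} \<times> M)) (\<lambda>p. y ^ fst p * (f (0, snd p) + (- 1) * q (0, snd p)))"
    by (rule spanned_linear_image)
      (auto simp: power_seq2_def power_seq_def case_prod_beta' intro!: spanned_basis image_eqI)
  then show ?thesis
    using q(1) by (subst fq) (auto intro!: spanned_add elim: spanned_mono)
qed

subsection \<open>Sums over walks\<close>

definition next_columns :: "nat \<Rightarrow> nat list \<Rightarrow> nat list set" where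
  "next_columns h C = {D. length D = h \<and> next_column C D}"

definition column_monom :: "nat list \<Rightarrow> mpoly" where
  "column_monom D = prod_list (map Var D)"

fun column_sum :: "nat list \<Rightarrow> nat list \<Rightarrow> mpoly" where
  "column_sum [] C = 1"
| "column_sum (h # hs) C = (\<Sum>D\<in>next_columns h C. column_monom D * column_sum hs D)"

text \<open>A pair \<open>(h, m)\<close> is a block of \<open>m\<close> columns of height
  \<open>h\<close>; the factor \<open>k\<close> accounts for stretching the rows by
  \<open>k\<close>.\<close>

definition block_heights :: "nat \<Rightarrow> (nat \<times> nat) list \<Rightarrow> nat list" where
  "block_heights k bs = concat (map (\<lambda>(h, m). replicate (k * m) h) bs)"

text \<open>The candidate roots: one column is picked per nonempty block and weighted with the width
  \<open>m\<close> of the block. Empty blocks are skipped, since no column there constrains the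
  walk.\<close>

fun block_monoms :: "(nat \<times> nat) list \<Rightarrow> nat list \<Rightarrow> mpoly set" where
  "block_monoms [] C = {1}"
| "block_monoms ((h, m) # bs) C =
     (if m = 0 then block_monoms bs C
      else {column_monom D ^ m * \<mu> |D \<mu>. D \<in> next_columns h C \<and> \<mu> \<in> block_monoms bs D})"

lemma finite_next_columns: "finite (next_columns h C)"
proof -
  have "D ! i \<le> Max (set C)" if "next_column C D" "i < length D" for D i
    using that unfolding next_column_def
    by (meson List.finite_set Max_ge nth_mem order_trans less_le_trans)
  then have "next_columns h C \<subseteq> {D. set D \<subseteq> {..Max (set C)} \<and> length D = h}"
    by (auto simp: next_columns_def in_set_conv_nth)
  then show ?thesis by (rule finite_subset) (simp add: finite_lists_length_eq)
qed

lemma column_monom_mset: "mset C = mset D \<Longrightarrow> column_monom C = column_monom D"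
  unfolding column_monom_def by (metis mset_map prod_mset_prod_list)

lemma column_monom_single:
  "column_monom D = Poly_Mapping.single (\<Sum>v\<leftarrow>D. Poly_Mapping.single v 1) 1"
  by (induction D) (simp_all add: column_monom_def Var_def mult_single)

lemma column_monom_neq_0: "column_monom D \<noteq> 0"
  by (simp add: column_monom_single)

text \<open>The exponent of \<open>v\<close> counts its occurrences. Columns with different entry
  sums therefore have different monomials, which excludes resonance.\<close>

lemma column_monom_eqD:
  assumes "column_monom C = column_monom D" shows "mset C = mset D"
proof -
  have count: "Poly_Mapping.lookup (\<Sum>v\<leftarrow>C. Poly_Mapping.single v (1::nat)) x = count (mset C) x" for x C
    by (induction C) (auto simp: lookup_add lookup_single when_def)
  have "(\<Sum>v\<leftarrow>C. Poly_Mapping.single v (1::nat)) = (\<Sum>v\<leftarrow>D. Poly_Mapping.single v 1)"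
    using assms unfolding column_monom_single
    by (metis lookup_single_eq lookup_single_not_eq zero_neq_one)
  then show ?thesis using count by (metis multiset_eqI)
qed

text \<open>Entrywise comparison; the entry sum is the measure for the induction in
  \<open>spanned_block_loop\<close>.\<close>

lemma next_columns_sum_list:
  assumes "D \<in> next_columns (length C) C"
  shows "sum_list D \<le> sum_list C" and "D \<noteq> C \<Longrightarrow> sum_list D < sum_list C"
proof -
  have D: "length D = length C" "\<And>i. i < length C \<Longrightarrow> D ! i \<le> C ! i"
    using assms by (auto simp: next_columns_def next_column_def)
  then show le: "sum_list D \<le> sum_list C"
    by (auto simp: sum_list_sum_nth intro!: sum_mono)
  assume "D \<noteq> C"
  then obtain i where i: "i < length C" "D ! i \<noteq> C ! i" using D by (auto simp: list_eq_iff_nth_eq)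
  then have "D ! i < C ! i" using D(2)[of i] by simp
  then show "sum_list D < sum_list C"
    using D i by (auto simp: sum_list_sum_nth intro!: sum_strict_mono_ex1)
qed

section \<open>Transport of contents along dominance\<close>

lemma dominating_next_column:
  assumes dom: "prefix_dominates C C'" and D': "D' \<in> next_columns h C'"
  shows "\<exists>D\<in>next_columns h C. column_monom D = column_monom D' \<and> prefix_dominates D D'"
proof -
  have next': "next_column C' D'" using D' by (simp add: next_columns_def)
  obtain D where D: "set D = set D'" "length D = length D'" "next_column C D" "prefix_dominates D D'"
    by (rule next_column_dominating[OF dom next'])
  have "mset D = mset D'"
    using D next' by (intro set_eq_iff_mset_eq_distinct[THEN iffD1] next_column_distinct)
  then have "column_monom D = column_monom D'" by (rule column_monom_mset)
  then show ?thesis using D D' by (auto simp: next_columns_def)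
qed

text \<open>Each picked column is replaced by a dominating one of the same content, which keeps the
  induction going. Through this, roots picked after skipping columns remain available.\<close>

lemma block_monoms_mono:
  "prefix_dominates C C' \<Longrightarrow> block_monoms bs C' \<subseteq> block_monoms bs C"
proof (induction bs arbitrary: C C')
  case (Cons b bs)
  obtain h m where b: "b = (h, m)" by force
  show ?case
  proof (cases "m = 0")
    case True
    then show ?thesis using Cons b by simp
  next
    case False
    show ?thesis
    proof
      fix x assume "x \<in> block_monoms (b # bs) C'"
      then obtain D' \<mu> where x: "x = column_monom D' ^ m * \<mu>"
        and D': "D' \<in> next_columns h C'" "\<mu> \<in> block_monoms bs D'"
        using False b by auto
      obtain D where D: "D \<in> next_columns h C" "column_monom D = column_monom D'" "prefix_dominates D D'"
        using dominating_next_column[OF Cons.prems D'(1)] by blast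
      have "x = column_monom D ^ m * \<mu>" "\<mu> \<in> block_monoms bs D"
        using x D D'(2) Cons.IH[OF D(3)] by auto
      then show "x \<in> block_monoms (b # bs) C" using False b D(1) by auto
    qed
  qed
qed simp

text \<open>The bases \<open>(e, \<mu>)\<close> of the sequences \<open>power_seq2\<close> for one
  block. They live in the fraction field because particular solutions divide by differences of
  monomials.\<close>

abbreviation block_pairs :: "nat \<Rightarrow> (nat \<times> nat) list \<Rightarrow> nat list \<Rightarrow> (mpoly fract \<times> mpoly fract) set" where
  "block_pairs h bs C \<equiv> {(to_fract (column_monom D), to_fract \<mu>) |D \<mu>.
     D \<in> next_columns h C \<and> \<mu> \<in> block_monoms bs D}"

lemma block_pairs_mono:
  assumes "D \<in> next_columns h C" shows "block_pairs h bs D \<subseteq> block_pairs h bs C"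
proof -
  have dom: "prefix_dominates C D"
    using assms by (auto simp: next_columns_def intro: next_column_prefix_dominates)
  show ?thesis
  proof
    fix x assume "x \<in> block_pairs h bs D"
    then obtain E \<mu> where x: "x = (to_fract (column_monom E), to_fract \<mu>)"
      and E: "E \<in> next_columns h D" "\<mu> \<in> block_monoms bs E" by blast
    obtain E' where E': "E' \<in> next_columns h C" "column_monom E' = column_monom E" "prefix_dominates E' E"
      using dominating_next_column[OF dom E(1)] by blast
    have "x = (to_fract (column_monom E'), to_fract \<mu>)" "\<mu> \<in> block_monoms bs E'"
      using x E' E(2) block_monoms_mono[OF E'(3)] by auto
    then show "x \<in> block_pairs h bs C" using E'(1) by blast
  qed
qed

lemma to_fract_sum: "to_fract (sum f A) = (\<Sum>x\<in>A. to_fract (f x))"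
  by (induction A rule: infinite_finite_induct) simp_all

lemma to_fract_power: "to_fract (x ^ n) = to_fract x ^ n"
  by (induction n) simp_all

text \<open>The loop at \<open>C\<close> contributes the factor \<open>y\<close> of the recursion in
  \<open>n\<close>; all other steps lead to columns of smaller entry sum, covered by induction, and
  form the inhomogeneous part.\<close>

lemma spanned_block_loop:
  fixes bs :: "(nat \<times> nat) list" and hs :: "nat \<Rightarrow> nat list"
  assumes IH: "\<And>C. spanned (power_seq ` to_fract ` block_monoms bs C) (\<lambda>k. to_fract (column_sum (hs k) C))"
    and "C \<in> next_columns h C"
  shows "spanned (power_seq2 ` block_pairs h bs C)
           (\<lambda>(n, k). to_fract (column_sum (replicate n h @ hs k) C))"
  using assms(2)
proof (induction "sum_list C" arbitrary: C rule: less_induct)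
  case less
  let ?f = "\<lambda>C (n, k). to_fract (column_sum (replicate n h @ hs k) C)"
  let ?N = "next_columns h C - {C}"
  let ?y = "to_fract (column_monom C)"
  have len: "length C = h" using less.prems by (simp add: next_columns_def)
  have loop: "D \<in> next_columns h D" if "D \<in> ?N" for D
    using that by (auto simp: next_columns_def intro: next_column_self)
  have smaller: "sum_list D < sum_list C" if "D \<in> ?N" for D
    using next_columns_sum_list(2)[of D C] that len by auto
  have r: "spanned (power_seq2 ` (\<Union>D\<in>?N. block_pairs h bs D)) (\<lambda>p. \<Sum>D\<in>?N. to_fract (column_monom D) * ?f D p)"
  proof (intro spanned_sum spanned_scale)
    fix D assume D: "D \<in> ?N"
    from less.hyps[OF smaller[OF D] loop[OF D]]
    show "spanned (power_seq2 ` (\<Union>D\<in>?N. block_pairs h bs D)) (?f D)"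
      by (rule spanned_mono) (use D in blast)
  qed
  have "spanned (power_seq2 ` ((\<Union>D\<in>?N. block_pairs h bs D) \<union> {?y} \<times> to_fract ` block_monoms bs C)) (?f C)"
    using r
  proof (rule spanned_recursion)
    show "spanned (power_seq ` to_fract ` block_monoms bs C) (\<lambda>k. ?f C (0, k))"
      using IH by simp
    show "?f C (Suc n, k) = ?y * ?f C (n, k) + (\<Sum>D\<in>?N. to_fract (column_monom D) * ?f D (n, k))" for n k
      using less.prems by (simp add: to_fract_sum sum.remove[OF finite_next_columns])
    fix e \<mu> assume "(e, \<mu>) \<in> (\<Union>D\<in>?N. block_pairs h bs D)"
    then obtain D E \<nu> where DE: "D \<in> ?N" "E \<in> next_columns h D" "\<nu> \<in> block_monoms bs E"
      and e: "e = to_fract (column_monom E)" "\<mu> = to_fract \<nu>" by blast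
    have "length D = h" using DE by (simp add: next_columns_def)
    \<comment> \<open>Whatever is reached through \<open>D\<close> has a smaller entry sum than
      \<open>C\<close>, hence another monomial: there is no resonance.\<close>
    then have "sum_list E < sum_list C"
      using next_columns_sum_list(1)[of E D] DE smaller[of D] by simp
    then have "column_monom E \<noteq> column_monom C"
      using column_monom_eqD by (metis less_irrefl sum_mset_sum_list)
    moreover have "prefix_dominates C D" "prefix_dominates D E"
      using DE by (auto simp: next_columns_def intro: next_column_prefix_dominates)
    \<comment> \<open>Jumping from \<open>C\<close> over \<open>D\<close> and \<open>E\<close> loses
      no later content: monotonicity is applied along the two dominances.\<close>
    then have "\<nu> \<in> block_monoms bs C"
      using DE(3) block_monoms_mono by blast
    ultimately show "e \<noteq> ?y \<and> \<mu> \<in> to_fract ` block_monoms bs C" by (simp add: e)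
  qed
  moreover have "(\<Union>D\<in>?N. block_pairs h bs D) \<union> {?y} \<times> to_fract ` block_monoms bs C \<subseteq> block_pairs h bs C"
    using less.prems block_pairs_mono by blast
  ultimately show ?case by (rule spanned_mono[OF _ image_mono])
qed

text \<open>Entering a block uses one step, possibly with a drop in height, so
  \<open>Suc k * m - 1\<close> steps inside it remain. Substituting this for \<open>n\<close> turns
  \<open>e ^ n * \<mu> ^ Suc k\<close> into a constant multiple of
  \<open>(e ^ m * \<mu>) ^ Suc k\<close>.\<close>

lemma spanned_column_sum:
  "spanned (power_seq ` to_fract ` block_monoms bs C)
     (\<lambda>k. to_fract (column_sum (block_heights (Suc k) bs) C))"
proof (induction bs arbitrary: C)
  case Nil
  have "(\<lambda>k. to_fract (column_sum (block_heights (Suc k) []) C)) = power_seq 1"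
    by (simp add: block_heights_def power_seq_def fun_eq_iff)
  then show ?case by (simp add: spanned_basis)
next
  case (Cons b bs)
  obtain h m where b: "b = (h, m)" by force
  let ?hs = "\<lambda>k. block_heights (Suc k) bs"
  let ?f = "\<lambda>C (n, k). to_fract (column_sum (replicate n h @ ?hs k) C)"
  have heights: "block_heights (Suc k) (b # bs) = replicate (Suc k * m) h @ ?hs k" for k
    by (simp add: block_heights_def b)
  show ?case
  proof (cases "m = 0")
    case True
    then show ?thesis using Cons[of C] by (simp add: block_heights_def b)
  next
    case False
    have "spanned (power_seq2 ` block_pairs h bs C)
        (\<lambda>p. \<Sum>D\<in>next_columns h C. to_fract (column_monom D) * ?f D p)"
    proof (intro spanned_sum spanned_scale)
      fix D assume D: "D \<in> next_columns h C"
      then have "D \<in> next_columns h D" by (auto simp: next_columns_def intro: next_column_self)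
      from spanned_block_loop[OF Cons this] show "spanned (power_seq2 ` block_pairs h bs C) (?f D)"
        by (rule spanned_mono) (rule image_mono[OF block_pairs_mono[OF D]])
    qed
    then have "spanned (power_seq ` to_fract ` block_monoms (b # bs) C)
        (\<lambda>k. 1 * (\<Sum>D\<in>next_columns h C. to_fract (column_monom D) * ?f D (Suc k * m - 1, k)))"
    proof (rule spanned_linear_image)
      fix g assume "g \<in> power_seq2 ` block_pairs h bs C"
      then obtain D \<mu> where D: "D \<in> next_columns h C" "\<mu> \<in> block_monoms bs D"
        and g: "g = power_seq2 (to_fract (column_monom D), to_fract \<mu>)" by blast
      let ?e = "to_fract (column_monom D)"
      \<comment> \<open>The one step spent on entering the block accounts for the factor
        \<open>1 / ?e\<close>, which is independent of \<open>k\<close>.\<close>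
      have "1 * g (Suc k * m - 1, k) = 1 / ?e * power_seq (to_fract (column_monom D ^ m * \<mu>)) k" for k
      proof -
        define q where "q = Suc k * m - 1"
        have q: "Suc q = Suc k * m" using False by (simp add: q_def)
        have "?e * ?e ^ q = (?e ^ m) ^ Suc k"
          by (simp only: power_Suc[symmetric] q power_mult[symmetric] mult.commute)
        moreover have "?e ^ q = 1 / ?e * (?e * ?e ^ q)" using column_monom_neq_0[of D] by simp
        ultimately have "?e ^ (Suc k * m - 1) = 1 / ?e * (?e ^ m) ^ Suc k" by (simp only: q_def)
        then show ?thesis
          by (simp only: g power_seq2_def power_seq_def prod.case to_fract_mult to_fract_power
              power_mult_distrib mult.assoc mult_1)
      qed
      moreover have "column_monom D ^ m * \<mu> \<in> block_monoms (b # bs) C"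
        using D False by (auto simp: b)
      ultimately show "spanned (power_seq ` to_fract ` block_monoms (b # bs) C) (\<lambda>k. 1 * g (Suc k * m - 1, k))"
        by (simp only:) (intro spanned_scale spanned_basis imageI)
    qed
    moreover have "column_sum (block_heights (Suc k) (b # bs)) C =
        (\<Sum>D\<in>next_columns h C. column_monom D * column_sum (replicate (Suc k * m - 1) h @ ?hs k) D)" for k
    proof -
      have "Suc k * m = Suc (Suc k * m - 1)" using False by simp
      then show ?thesis unfolding heights by (metis append_Cons column_sum.simps(2) replicate_Suc)
    qed
    ultimately show ?thesis by (simp add: to_fract_sum)
  qed
qed

section \<open>From power sequences to the recurrence\<close>

lemma recurrence_if_spanned:
  fixes a :: "nat \<Rightarrow> 'a::idom"
  assumes M: "finite M" and a: "spanned (power_seq ` to_fract ` M) (\<lambda>k. to_fract (a (Suc k)))"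
  shows "satisfies_linear_recurrence a 1 (\<Prod>m\<in>M. [:- m, 1:])"
proof -
  define \<chi> where "\<chi> = (\<Prod>m\<in>M. [:- m, 1:])"
  define d where "d = degree \<chi>"
  \<comment> \<open>By linearity it suffices to treat a power sequence, for which the sum is a power
    of \<open>m\<close> times \<open>poly \<chi> m\<close>, and \<open>m\<close> is a root of
    \<open>\<chi>\<close>.\<close>
  have kill: "(\<Sum>i = 0..d. to_fract (coeff \<chi> (d - i)) * f (k - i)) = 0"
    if "spanned (power_seq ` to_fract ` M) f" "d \<le> k" for f k
    using that(1)
  proof (induction f rule: spanned.induct)
    case (add_basis b f c)
    then obtain m where m: "m \<in> M" "b = power_seq (to_fract m)" by blast
    have "(\<Sum>i = 0..d. coeff \<chi> (d - i) * m ^ Suc (k - i)) =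
        m ^ Suc (k - d) * (\<Sum>i = 0..d. coeff \<chi> (d - i) * m ^ (d - i))"
      unfolding sum_distrib_left
    proof (rule sum.cong)
      fix i assume "i \<in> {0..d}"
      then have "Suc (k - i) = Suc (k - d) + (d - i)" using \<open>d \<le> k\<close> by simp
      then show "coeff \<chi> (d - i) * m ^ Suc (k - i) = m ^ Suc (k - d) * (coeff \<chi> (d - i) * m ^ (d - i))"
        by (simp only: power_add mult_ac)
    qed simp
    also have "(\<Sum>i = 0..d. coeff \<chi> (d - i) * m ^ (d - i)) = poly \<chi> m"
      unfolding poly_altdef d_def atMost_atLeast0 by (rule sum.atLeastAtMost_rev[THEN trans]) simp
    also have "poly \<chi> m = 0"
      using m M by (auto simp: \<chi>_def poly_prod intro!: prod_zero bexI[of _ m])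
    finally have "to_fract (\<Sum>i = 0..d. coeff \<chi> (d - i) * m ^ Suc (k - i)) = 0" by simp
    then have "(\<Sum>i = 0..d. to_fract (coeff \<chi> (d - i)) * b (k - i)) = 0"
      by (simp only: to_fract_sum to_fract_mult to_fract_power m power_seq_def)
    then have "(\<Sum>i = 0..d. c * (to_fract (coeff \<chi> (d - i)) * b (k - i))) = 0"
      by (simp only: sum_distrib_left[symmetric] mult_zero_right)
    then show ?case using add_basis.IH by (simp add: algebra_simps sum.distrib)
  qed simp
  have "(\<Sum>i = 0..d. coeff \<chi> (d - i) * a (k - i)) = 0" if "k \<ge> 1 + d" for k
  proof -
    \<comment> \<open>As \<open>i \<le> d < k\<close>, the index \<open>k - i\<close> is positive
      and equals \<open>Suc (k - 1 - i)\<close>, so \<open>kill\<close> applies at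
      \<open>k - 1\<close>. Injectivity of \<open>to_fract\<close> then brings the identity back to
      the ring.\<close>
    have "to_fract (\<Sum>i = 0..d. coeff \<chi> (d - i) * a (k - i)) =
        (\<Sum>i = 0..d. to_fract (coeff \<chi> (d - i)) * to_fract (a (Suc (k - 1 - i))))"
      unfolding to_fract_sum to_fract_mult
      using that by (intro sum.cong) (auto simp: Suc_diff_Suc Suc_diff_le)
    also have "\<dots> = 0" using that by (intro kill[OF a]) simp
    finally show ?thesis by (simp only: to_fract_eq_0_iff)
  qed
  moreover have "lead_coeff \<chi> = 1" by (simp add: \<chi>_def lead_coeff_prod)
  ultimately show ?thesis by (simp add: satisfies_linear_recurrence_def \<chi>_def d_def)
qed

subsection \<open>Tableaux as walks\<close>

fun column_chains :: "nat list \<Rightarrow> nat list \<Rightarrow> nat list list set" where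
  "column_chains [] C = {[]}"
| "column_chains (h # hs) C = (\<Union>D\<in>next_columns h C. (#) D ` column_chains hs D)"

lemma finite_column_chains: "finite (column_chains hs C)"
  by (induction hs arbitrary: C) (auto simp: finite_next_columns)

lemma column_sum_chains:
  "column_sum hs C = (\<Sum>Ds\<in>column_chains hs C. prod_list (map column_monom Ds))"
proof (induction hs arbitrary: C)
  case (Cons h hs)
  have "(\<Sum>Ds\<in>column_chains (h # hs) C. prod_list (map column_monom Ds)) =
      (\<Sum>D\<in>next_columns h C. \<Sum>Ds\<in>(#) D ` column_chains hs D. prod_list (map column_monom Ds))"
    unfolding column_chains.simps
    by (rule sum.UNION_disjoint) (auto simp: finite_next_columns finite_column_chains)
  also have "\<dots> = (\<Sum>D\<in>next_columns h C. \<Sum>Ds\<in>column_chains hs D.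
      column_monom D * prod_list (map column_monom Ds))"
    by (rule sum.cong) (simp_all add: sum.reindex)
  finally show ?case by (simp add: Cons sum_distrib_left)
qed simp

text \<open>In \<open>C # Ds\<close>, position \<open>j\<close> holds the left neighbour of
  \<open>Ds ! j\<close>, with \<open>C\<close> preceding the first column.\<close>

lemma column_chains_iff:
  "Ds \<in> column_chains hs C \<longleftrightarrow>
     map length Ds = hs \<and> (\<forall>j<length Ds. next_column ((C # Ds) ! j) (Ds ! j))"
proof (induction hs arbitrary: C Ds)
  case (Cons h hs)
  show ?case
  proof (cases Ds)
    case (Cons D Ds')
    have "Ds \<in> column_chains (h # hs) C \<longleftrightarrow> D \<in> next_columns h C \<and> Ds' \<in> column_chains hs D"
      by (auto simp: Cons)
    then show ?thesis
      by (auto simp: Cons Cons.IH next_columns_def All_less_Suc2)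
  qed auto
qed auto

lemma replicate_in_column_chains:
  assumes "D \<in> next_columns h D" "Ds \<in> column_chains hs D"
  shows "replicate m D @ Ds \<in> column_chains (replicate m h @ hs) D"
  using assms by (induction m) auto

text \<open>Each picked column is repeated through its loop to fill its block. Blocks have distinct
  heights, so columns of equal height come from one block and coincide.\<close>

lemma block_monoms_chain:
  assumes "\<mu> \<in> block_monoms bs C" "distinct (map fst bs)"
  shows "\<exists>Ds\<in>column_chains (block_heights 1 bs) C. prod_list (map column_monom Ds) = \<mu> \<and>
    (\<forall>D\<in>set Ds. \<forall>D'\<in>set Ds. length D = length D' \<longrightarrow> D = D')"
  using assms
proof (induction bs arbitrary: C \<mu>)
  case Nil
  then show ?case by (simp add: block_heights_def)
next
  case (Cons b bs)
  obtain h m where b: "b = (h, m)" by force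
  have heights: "block_heights 1 (b # bs) = replicate m h @ block_heights 1 bs"
    by (simp add: block_heights_def b)
  show ?case
  proof (cases m)
    case 0
    then show ?thesis using Cons b by (simp add: block_heights_def)
  next
    case (Suc n)
    then obtain D \<nu> where D: "D \<in> next_columns h C" "\<nu> \<in> block_monoms bs D"
      and \<mu>: "\<mu> = column_monom D ^ m * \<nu>"
      using Cons.prems(1) b by auto
    then obtain Ds where Ds: "Ds \<in> column_chains (block_heights 1 bs) D"
      "prod_list (map column_monom Ds) = \<nu>"
      "\<forall>D\<in>set Ds. \<forall>D'\<in>set Ds. length D = length D' \<longrightarrow> D = D'"
      using Cons.IH Cons.prems(2) by auto
    have loop: "D \<in> next_columns h D"
      using D by (auto simp: next_columns_def intro: next_column_self)
    have "replicate m D @ Ds \<in> column_chains (block_heights 1 (b # bs)) C"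
      using replicate_in_column_chains[OF loop Ds(1), of n] D(1) unfolding heights Suc by auto
    moreover have "prod_list (map column_monom (replicate m D @ Ds)) = \<mu>"
      using Ds(2) \<mu> by (simp add: prod_list_replicate)
    moreover have "length E \<noteq> length D" if "E \<in> set Ds" for E
    proof -
      have "length E \<in> set (map length Ds)" using that by simp
      also have "map length Ds = block_heights 1 bs" using Ds(1) by (simp add: column_chains_iff)
      finally have "length E \<in> fst ` set bs" by (force simp: block_heights_def)
      moreover have "length D = h" using loop by (simp add: next_columns_def)
      moreover have "h \<notin> fst ` set bs" using Cons.prems(2) b by simp
      ultimately show ?thesis by metis
    qed
    then have "E = E'" if "E \<in> set (replicate m D @ Ds)" "E' \<in> set (replicate m D @ Ds)"
        "length E = length E'" for E E'
      using that Ds(3) by (metis Un_iff in_set_replicate set_append)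
    ultimately show ?thesis by blast
  qed
qed

section \<open>Column heights of a partition\<close>

text \<open>
  For a partition \<open>l\<close>, the pairs \<open>(h, m)\<close> list each height \<open>h\<close> with the number \<open>m\<close> (possibly
  \<open>0\<close>) of columns of that height.
\<close>

fun shape_blocks :: "nat list \<Rightarrow> nat \<Rightarrow> (nat \<times> nat) list" where
  "shape_blocks l 0 = []"
| "shape_blocks l (Suc d) = (Suc d, l ! d - (if Suc d < length l then l ! Suc d else 0)) # shape_blocks l d"

lemma shape_blocks_le: "(h, m) \<in> set (shape_blocks l d) \<Longrightarrow> h \<le> d"
  by (induction d) auto

lemma distinct_shape_blocks: "distinct (map fst (shape_blocks l d))"
  by (induction d) (auto dest: shape_blocks_le)

text \<open>Block widths are differences of consecutive parts, hence scale with the parts.\<close>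

lemma block_heights_scale:
  "d \<le> length l \<Longrightarrow> block_heights 1 (shape_blocks (map ((*) k) l) d) = block_heights k (shape_blocks l d)"
  by (induction d) (auto simp: block_heights_def diff_mult_distrib2)

text \<open>For a partition \<open>l\<close> this is its conjugate, from the leftmost, tallest
  column on.\<close>

definition column_heights :: "nat list \<Rightarrow> nat list" where
  "column_heights l = block_heights 1 (shape_blocks l (length l))"

lemma column_heights_nth:
  assumes sorted: "sorted_wrt (\<ge>) l"
  shows "j < length (column_heights l) \<and> i < column_heights l ! j \<longleftrightarrow> i < length l \<and> j < l ! i"
    and "j < length (column_heights l) \<Longrightarrow> 0 < column_heights l ! j"
proof -
  \<comment> \<open>Padding with zeros makes \<open>lam (length l) = 0\<close>, so the claim below
    for \<open>d = length l\<close> describes the whole diagram.\<close>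
  define lam where "lam i = (if i < length l then l ! i else 0)" for i
  define hs where "hs d = block_heights 1 (shape_blocks l d)" for d
  have anti: "lam j \<le> lam i" if "i \<le> j" for i j
    using that sorted by (cases "i = j") (auto simp: lam_def sorted_wrt_iff_nth_less)
  have hs: "hs (Suc d) = replicate (lam d - lam (Suc d)) (Suc d) @ hs d" if "d < length l" for d
    using that by (simp add: hs_def block_heights_def lam_def)
  \<comment> \<open>\<open>hs d\<close> lists the columns of height at most \<open>d\<close>; these
    start after the first \<open>lam d\<close> columns, whence the shift in
    \<open>j + lam d\<close>.\<close>
  have *: "length (hs d) = lam 0 - lam d \<and>
      (\<forall>j<length (hs d). \<forall>i. i < hs d ! j \<longleftrightarrow> i < d \<and> j + lam d < lam i)" if "d \<le> length l" for d
    using that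
  proof (induction d)
    case 0
    then show ?case by (simp add: hs_def block_heights_def)
  next
    case (Suc d)
    have IH: "length (hs d) = lam 0 - lam d"
      "\<And>j i. j < length (hs d) \<Longrightarrow> i < hs d ! j \<longleftrightarrow> i < d \<and> j + lam d < lam i" using Suc by auto
    have le: "lam (Suc d) \<le> lam d" "lam d \<le> lam 0" using anti by auto
    have hsd: "hs (Suc d) = replicate (lam d - lam (Suc d)) (Suc d) @ hs d" using hs Suc by simp
    show ?case
    proof (intro conjI allI impI)
      show len: "length (hs (Suc d)) = lam 0 - lam (Suc d)" using IH(1) le by (simp add: hsd)
      fix j i assume j: "j < length (hs (Suc d))"
      show "i < hs (Suc d) ! j \<longleftrightarrow> i < Suc d \<and> j + lam (Suc d) < lam i"
      proof (cases "j < lam d - lam (Suc d)")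
        case True
        then have "j + lam (Suc d) < lam i" if "i < Suc d" using anti[of i d] that by simp
        then show ?thesis using True by (auto simp: hsd nth_append)
      next
        case False
        let ?j = "j - (lam d - lam (Suc d))"
        have "?j < length (hs d)" using j False by (simp add: hsd)
        moreover have "?j + lam d = j + lam (Suc d)" using False le by simp
        ultimately have "i < hs (Suc d) ! j \<longleftrightarrow> i < d \<and> j + lam (Suc d) < lam i"
          using IH(2)[of ?j i] False by (simp add: hsd nth_append)
        then show ?thesis using False by (auto simp: less_Suc_eq)
      qed
    qed
  qed
  have len: "length (column_heights l) = lam 0"
    using *[of "length l"] by (simp add: column_heights_def hs_def lam_def)
  have nth: "i < column_heights l ! j \<longleftrightarrow> i < length l \<and> j < lam i" if "j < length (column_heights l)" for i j
    using *[of "length l"] that by (simp add: column_heights_def hs_def lam_def)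
  show "j < length (column_heights l) \<and> i < column_heights l ! j \<longleftrightarrow> i < length l \<and> j < l ! i"
  proof (cases "j < length (column_heights l)")
    case True
    then show ?thesis using nth[of j i] by (auto simp: lam_def)
  next
    case False
    then have "\<not> j < lam i" using len anti[of 0 i] by simp
    then show ?thesis using False by (auto simp: lam_def split: if_splits)
  qed
  assume j: "j < length (column_heights l)"
  then have "j < lam 0" by (simp add: len)
  moreover have "0 < length l" using calculation by (auto simp: lam_def split: if_splits)
  ultimately show "0 < column_heights l ! j" using nth[OF j, of 0] by simp
qed

section \<open>Correspondence between key tableaux and chains of columns\<close>

locale key_shape =
  fixes b l :: "nat list"
  assumes length_eq: "length b = length l" and distinct_b: "distinct b"
    and b_pos: "v \<in> set b \<Longrightarrow> 0 < v" and sorted_l: "sorted_wrt (\<ge>) l"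
begin

abbreviation "hts \<equiv> column_heights l"

definition columns_of :: "(nat \<Rightarrow> nat \<Rightarrow> nat) \<Rightarrow> nat list list" where
  "columns_of T = map (\<lambda>j. map (\<lambda>i. T i (Suc j)) [0..<hts ! j]) [0..<length hts]"

text \<open>Prepending the basement makes list positions agree with column numbers. The value
  \<open>0\<close> elsewhere is the one prescribed by \<open>augmented_filling\<close>, so that
  passing to columns and back restores the tableau as a function.\<close>

definition filling_of :: "nat list list \<Rightarrow> nat \<Rightarrow> nat \<Rightarrow> nat" where
  "filling_of Ds i j = (if j \<le> length Ds \<and> i < length ((b # Ds) ! j) then (b # Ds) ! j ! i else 0)"

lemma boxes_Suc: "(i, Suc j) \<in> boxes l \<longleftrightarrow> j < length hts \<and> i < hts ! j"
  using column_heights_nth(1)[OF sorted_l, of j i] by (auto simp: boxes_def)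

lemma boxes_0: "(i, 0) \<notin> boxes l"
  by (simp add: boxes_def)

lemma hts_le: "j < length hts \<Longrightarrow> hts ! j \<le> length l"
  using column_heights_nth(1)[OF sorted_l, of j] by (meson not_le order.irrefl)

lemma hts_antimono: "Suc j < length hts \<Longrightarrow> hts ! Suc j \<le> hts ! j"
  using column_heights_nth(1)[OF sorted_l, of j] column_heights_nth(1)[OF sorted_l, of "Suc j"]
  by (meson Suc_lessD not_le order.irrefl)

lemma key_tableau_iff:
  "key_tableau b l T \<longleftrightarrow>
     (\<forall>i<length l. T i 0 = b ! i) \<and>
     (\<forall>j<length hts. \<forall>i<hts ! j. 0 < T i (Suc j)) \<and>
     (\<forall>i j. (i, j) \<notin> boxes l \<and> \<not> (i < length l \<and> j = 0) \<longrightarrow> T i j = 0) \<and>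
     (\<forall>j<length hts. \<forall>i<hts ! j. T i (Suc j) \<le> T i j) \<and>
     (\<forall>j<length hts. \<forall>i i'. i < i' \<and> i' < hts ! j \<longrightarrow>
        \<not> (T i (Suc j) \<le> T i' (Suc j) \<and> T i' (Suc j) \<le> T i j))"
proof -
  have 1: "(\<forall>(i, j)\<in>boxes l. P i j) \<longleftrightarrow> (\<forall>j<length hts. \<forall>i<hts ! j. P i (Suc j))" for P
  proof
    assume R: "\<forall>j<length hts. \<forall>i<hts ! j. P i (Suc j)"
    have "P i j" if "(i, j) \<in> boxes l" for i j
      using R that boxes_0 boxes_Suc by (cases j) auto
    then show "\<forall>(i, j)\<in>boxes l. P i j" by blast
  qed (use boxes_Suc in blast)
  have 2: "(\<nexists>a b c. inversion_triple l T a b c) \<longleftrightarrow>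
     (\<forall>j<length hts. \<forall>i i'. i < i' \<and> i' < hts ! j \<longrightarrow>
        \<not> (T i (Suc j) \<le> T i' (Suc j) \<and> T i' (Suc j) \<le> T i j))" (is "?L \<longleftrightarrow> ?R")
  proof
    assume L: ?L
    show ?R
    proof (intro allI impI notI)
      fix j i i' assume j: "j < length hts" and i: "i < i' \<and> i' < hts ! j"
        and T: "T i (Suc j) \<le> T i' (Suc j) \<and> T i' (Suc j) \<le> T i j"
      have "i' < length l" using hts_le[OF j] i by simp
      \<comment> \<open>Row \<open>i\<close> lies above row \<open>i'\<close>, so the partition
        supplies the length condition of an inversion triple.\<close>
      then have "l ! i' \<le> l ! i" using sorted_l i by (simp add: sorted_wrt_iff_nth_less)
      then have "inversion_triple l T (i, j) (i, Suc j) (i', Suc j)"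
        using j i T by (simp add: inversion_triple_def boxes_Suc)
      then show False using L by blast
    qed
  next
    assume R: ?R
    show ?L
    proof (intro notI, elim exE)
      fix p q r assume inv: "inversion_triple l T p q r"
      obtain i j i' where "p = (i, j)" "q = (i, Suc j)" "r = (i', Suc j)"
        using inv by (cases p; cases q; cases r) (auto simp: inversion_triple_def)
      then show False using inv R by (auto simp: inversion_triple_def boxes_Suc)
    qed
  qed
  show ?thesis
    unfolding key_tableau_def augmented_filling_def rows_weakly_decreasing_def 1 2
    by (simp add: length_eq distinct_b b_pos sorted_l)
qed

lemma key_tableau_basement: "key_tableau b l T \<Longrightarrow> i < length l \<Longrightarrow> T i 0 = b ! i"
  unfolding key_tableau_iff by blast

lemma columns_of_nth: "j < length hts \<Longrightarrow> columns_of T ! j = map (\<lambda>i. T i (Suc j)) [0..<hts ! j]"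
  by (simp add: columns_of_def)

text \<open>Lets the basement and the inner columns be treated alike as left neighbours of
  \<open>columns_of T ! j\<close>.\<close>

lemma basement_columns_nth:
  assumes "key_tableau b l T" "j < length hts"
  shows "hts ! j \<le> length ((b # columns_of T) ! j)"
    and "i < hts ! j \<Longrightarrow> (b # columns_of T) ! j ! i = T i j"
proof -
  have "hts ! j \<le> length ((b # columns_of T) ! j) \<and>
      (i < hts ! j \<longrightarrow> (b # columns_of T) ! j ! i = T i j)"
  proof (cases j)
    case 0
    then show ?thesis
      using hts_le[OF assms(2)] key_tableau_basement[OF assms(1), of i] by (simp add: length_eq)
  next
    case (Suc j')
    then show ?thesis
      using hts_antimono[of j'] assms(2) by (simp add: columns_of_nth)
  qed
  then show "hts ! j \<le> length ((b # columns_of T) ! j)"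
    and "i < hts ! j \<Longrightarrow> (b # columns_of T) ! j ! i = T i j" by simp_all
qed

lemma columns_of_chain:
  assumes T: "key_tableau b l T" shows "columns_of T \<in> column_chains hts b"
  unfolding column_chains_iff
proof (intro conjI allI impI)
  show "map length (columns_of T) = hts" by (simp add: columns_of_def o_def map_nth)
  fix j assume "j < length (columns_of T)"
  then have j: "j < length hts" by (simp add: columns_of_def)
  have T': "\<forall>i<hts ! j. 0 < T i (Suc j)" "\<forall>i<hts ! j. T i (Suc j) \<le> T i j"
    "\<forall>i i'. i < i' \<and> i' < hts ! j \<longrightarrow> \<not> (T i (Suc j) \<le> T i' (Suc j) \<and> T i' (Suc j) \<le> T i j)"
    using T j unfolding key_tableau_iff by blast+
  show "next_column ((b # columns_of T) ! j) (columns_of T ! j)"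
    unfolding next_column_def
  proof (intro conjI allI impI)
    show "length (columns_of T ! j) \<le> length ((b # columns_of T) ! j)"
      using basement_columns_nth(1)[OF T j] by (simp add: columns_of_nth[OF j])
    show "0 \<notin> set (columns_of T ! j)"
      using T'(1) by (force simp: columns_of_nth[OF j])
    show "columns_of T ! j ! i \<le> (b # columns_of T) ! j ! i" if "i < length (columns_of T ! j)" for i
      using that T'(2) basement_columns_nth(2)[OF T j, of i] by (simp add: columns_of_nth[OF j])
    fix i i' assume i: "i < i' \<and> i' < length (columns_of T ! j)"
    then have i': "i < i'" "i' < hts ! j" "i < hts ! j" by (simp_all add: columns_of_nth[OF j])
    then show "\<not> (columns_of T ! j ! i \<le> columns_of T ! j ! i' \<and>
        columns_of T ! j ! i' \<le> (b # columns_of T) ! j ! i)"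
      unfolding basement_columns_nth(2)[OF T j i'(3)] using T'(3) by (simp add: columns_of_nth[OF j])
  qed
qed

lemma filling_of_columns_of:
  assumes T: "key_tableau b l T" shows "filling_of (columns_of T) = T"
proof (intro ext)
  fix i j
  have out: "(i, j) \<notin> boxes l \<and> \<not> (i < length l \<and> j = 0) \<longrightarrow> T i j = 0"
    and zero: "\<forall>i<length l. T i 0 = b ! i"
    using T unfolding key_tableau_iff by blast+
  show "filling_of (columns_of T) i j = T i j"
  proof (cases j)
    case 0
    then show ?thesis using zero out boxes_0 by (auto simp: filling_of_def length_eq)
  next
    case (Suc j')
    have "length (columns_of T) = length hts" by (simp add: columns_of_def)
    then show ?thesis
      using Suc out boxes_Suc[of i j'] by (auto simp: filling_of_def columns_of_nth Suc_le_eq)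
  qed
qed

context
  fixes Ds assumes Ds: "Ds \<in> column_chains hts b"
begin

lemma chain_lengths: "length Ds = length hts" "j < length hts \<Longrightarrow> length (Ds ! j) = hts ! j"
proof -
  have hts: "hts = map length Ds" using Ds by (simp add: column_chains_iff)
  show "length Ds = length hts" "j < length hts \<Longrightarrow> length (Ds ! j) = hts ! j"
    by (simp_all add: hts)
qed

lemma filling_of_Suc: "j < length hts \<Longrightarrow> i < hts ! j \<Longrightarrow> filling_of Ds i (Suc j) = Ds ! j ! i"
  by (simp add: filling_of_def chain_lengths)

lemma columns_of_filling_of: "columns_of (filling_of Ds) = Ds"
proof (rule nth_equalityI)
  show "length (columns_of (filling_of Ds)) = length Ds" by (simp add: columns_of_def chain_lengths)
  fix j assume "j < length (columns_of (filling_of Ds))"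
  then have j: "j < length hts" by (simp add: columns_of_def)
  show "columns_of (filling_of Ds) ! j = Ds ! j"
    by (rule nth_equalityI) (simp_all add: columns_of_nth j chain_lengths filling_of_Suc)
qed

lemma filling_of_key_tableau: "key_tableau b l (filling_of Ds)"
  unfolding key_tableau_iff
proof (intro conjI allI impI)
  show "filling_of Ds i 0 = b ! i" if "i < length l" for i
    using that by (simp add: filling_of_def length_eq)
  show "filling_of Ds i j = 0" if "(i, j) \<notin> boxes l \<and> \<not> (i < length l \<and> j = 0)" for i j
    using that by (cases j) (auto simp: filling_of_def length_eq boxes_Suc chain_lengths)
  fix j assume j: "j < length hts"
  have nxt: "next_column ((b # Ds) ! j) (Ds ! j)"
    using Ds j by (simp add: column_chains_iff chain_lengths(1))
  have prev: "filling_of Ds i j = (b # Ds) ! j ! i" if "i < hts ! j" for i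
    using that nxt j by (simp add: filling_of_def chain_lengths next_column_def)
  show "0 < filling_of Ds i (Suc j)" if "i < hts ! j" for i
    using that nxt j by (simp add: filling_of_Suc chain_lengths next_column_def)
      (metis chain_lengths(2) gr0I nth_mem)
  show "filling_of Ds i (Suc j) \<le> filling_of Ds i j" if "i < hts ! j" for i
    using that nxt j by (simp add: filling_of_Suc prev chain_lengths next_column_def)
  show "\<not> (filling_of Ds i (Suc j) \<le> filling_of Ds i' (Suc j) \<and> filling_of Ds i' (Suc j) \<le> filling_of Ds i j)"
    if "i < i' \<and> i' < hts ! j" for i i'
    using that nxt j by (simp add: filling_of_Suc prev chain_lengths next_column_def)
qed

end

text \<open>Grouping the boxes by entry turns the powers of variables into a product over boxes,
  which is then taken column by column. No box is lost, since entries are positive and bounded by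
  the basement.\<close>

lemma weight_monom_columns:
  assumes T: "key_tableau b l T" and n: "\<And>v. v \<in> set b \<Longrightarrow> v \<le> n"
  shows "weight_monom n l T = prod_list (map column_monom (columns_of T))"
proof -
  have boxes: "boxes l = (\<lambda>(j, i). (i, Suc j)) ` Sigma {..<length hts} (\<lambda>j. {..<hts ! j})"
  proof -
    have "(i, j) \<in> boxes l \<longleftrightarrow> (\<exists>j'. j = Suc j' \<and> j' < length hts \<and> i < hts ! j')" for i j
      using boxes_0 boxes_Suc by (cases j) auto
    then show ?thesis by force
  qed
  then have fin: "finite (boxes l)" by simp
  have range: "T i j \<in> {1..n}" if ij: "(i, j) \<in> boxes l" for i j
  proof -
    have "i < length l" "j \<le> l ! i" using ij by (auto simp: boxes_def)
    then have "T i j \<le> b ! i" "b ! i \<le> n"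
      using key_tableau_le_basement[OF T] n length_eq by simp_all
    moreover have "0 < T i j" using T ij by (auto simp: key_tableau_def augmented_filling_def)
    ultimately show ?thesis by simp
  qed
  have "weight_monom n l T = (\<Prod>v=1..n. \<Prod>p\<in>{p \<in> boxes l. case_prod T p = v}. Var (case_prod T p))"
    unfolding weight_monom_def weight_def by (auto intro!: prod.cong arg_cong[where f = "\<lambda>S. _ ^ card S"])
  also have "\<dots> = (\<Prod>p\<in>boxes l. Var (case_prod T p))"
    using fin range by (intro prod.group) auto
  also have "\<dots> = (\<Prod>(j, i)\<in>Sigma {..<length hts} (\<lambda>j. {..<hts ! j}). Var (T i (Suc j)))"
    unfolding boxes by (subst prod.reindex) (auto simp: inj_on_def case_prod_beta' intro!: prod.cong)
  also have "\<dots> = (\<Prod>j<length hts. \<Prod>i<hts ! j. Var (T i (Suc j)))"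
    by (simp add: prod.Sigma)
  also have "\<dots> = prod_list (map column_monom (columns_of T))"
    by (simp add: columns_of_def column_monom_def o_def prod.distinct_set_conv_list[symmetric]
        atLeast0LessThan)
  finally show ?thesis .
qed

lemma key_tableaux_sum:
  assumes "\<And>v. v \<in> set b \<Longrightarrow> v \<le> n"
  shows "(\<Sum>T | key_tableau b l T. weight_monom n l T) = column_sum hts b"
  unfolding column_sum_chains
proof (rule sum.reindex_bij_witness[where i = filling_of and j = columns_of])
  fix T assume "T \<in> {T. key_tableau b l T}"
  then have T: "key_tableau b l T" by simp
  show "filling_of (columns_of T) = T" using T by (rule filling_of_columns_of)
  show "columns_of T \<in> column_chains hts b" using T by (rule columns_of_chain)
  show "prod_list (map column_monom (columns_of T)) = weight_monom n l T"
    using weight_monom_columns[OF T assms] by simp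
next
  fix Ds assume Ds: "Ds \<in> column_chains hts b"
  show "columns_of (filling_of Ds) = Ds" using Ds by (rule columns_of_filling_of)
  show "filling_of Ds \<in> {T. key_tableau b l T}" using filling_of_key_tableau[OF Ds] by simp
qed

lemma column_columns_of:
  "column l T (Suc j) = (if j < length hts then columns_of T ! j else [])"
proof (cases "j < length hts")
  case True
  have "[0..<length l] = [0..<hts ! j] @ [hts ! j..<length l]"
    using hts_le[OF True] by (metis le_add_diff_inverse upt_add_eq_append zero_le)
  then have "filter (\<lambda>i. (i, Suc j) \<in> boxes l) [0..<length l] = [0..<hts ! j]"
    using True by (simp add: boxes_Suc)
  then show ?thesis using True by (simp add: column_def columns_of_nth)
qed (simp add: column_def boxes_Suc)

lemma equal_height_columns_agreeI:
  assumes "\<And>D D'. D \<in> set (columns_of T) \<Longrightarrow> D' \<in> set (columns_of T) \<Longrightarrow> length D = length D' \<Longrightarrow> D = D'"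
  shows "equal_height_columns_agree l T"
  unfolding equal_height_columns_agree_def
proof (intro allI impI)
  fix j j' :: nat
  assume "1 \<le> j" "1 \<le> j'" and len: "length (column l T j) = length (column l T j')"
  then obtain m m' where m: "j = Suc m" "j' = Suc m'" by (metis Suc_le_D One_nat_def)
  \<comment> \<open>Columns beyond the width of the shape are empty; they agree with each other and
    never have the height of an actual column.\<close>
  have pos: "0 < length (columns_of T ! j)" if "j < length hts" for j
    using that column_heights_nth(2)[OF sorted_l] by (simp add: columns_of_nth)
  have mem: "columns_of T ! j \<in> set (columns_of T)" if "j < length hts" for j
    using that by (simp add: columns_of_def)
  show "column l T j = column l T j'"
    using len assms[OF mem mem] pos[of m] pos[of m'] unfolding m column_columns_of
    by (auto split: if_splits)
qed

text \<open>The chain that repeats the picked columns is read back as a tableau, which realizes the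
  candidate root as a weight.\<close>

lemma block_monoms_subset:
  assumes n: "\<And>v. v \<in> set b \<Longrightarrow> v \<le> n"
  shows "block_monoms (shape_blocks l (length l)) b \<subseteq>
    weight_monom n l ` {T. key_tableau b l T \<and> equal_height_columns_agree l T}"
proof
  fix \<mu> assume "\<mu> \<in> block_monoms (shape_blocks l (length l)) b"
  then obtain Ds where Ds: "Ds \<in> column_chains hts b" "prod_list (map column_monom Ds) = \<mu>"
    "\<forall>D\<in>set Ds. \<forall>D'\<in>set Ds. length D = length D' \<longrightarrow> D = D'"
    using block_monoms_chain distinct_shape_blocks unfolding column_heights_def by blast
  have "key_tableau b l (filling_of Ds)" using Ds(1) by (rule filling_of_key_tableau)
  moreover have "equal_height_columns_agree l (filling_of Ds)"
    using Ds(3) by (intro equal_height_columns_agreeI) (simp add: columns_of_filling_of[OF Ds(1)])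
  moreover have "weight_monom n l (filling_of Ds) = \<mu>"
    using Ds by (simp add: weight_monom_columns n filling_of_key_tableau columns_of_filling_of)
  ultimately show "\<mu> \<in> weight_monom n l ` {T. key_tableau b l T \<and> equal_height_columns_agree l T}"
    by blast
qed

end

subsection \<open>Key polynomials of scaled compositions\<close>

lemma key_shape_of: "key_shape (basement_of \<alpha>) (shape_of \<alpha>)"
  by standard (use basement_of_wf sorted_shape_of in auto)

lemma key_poly_column_sum:
  "key_poly \<alpha> = column_sum (column_heights (shape_of \<alpha>)) (basement_of \<alpha>)"
  unfolding key_poly_def
  by (rule key_shape.key_tableaux_sum[OF key_shape_of]) (use basement_of_wf in auto)

text \<open>Insertion sort looks only at comparisons of keys, which \<open>g\<close>
  preserves.\<close>

lemma sort_key_map: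
  assumes "\<And>x y. f' (g x) \<le> f' (g y) \<longleftrightarrow> f x \<le> f y"
  shows "sort_key f' (map g xs) = map g (sort_key f xs)"
proof -
  have "insort_key f' (g x) (map g ys) = map g (insort_key f x ys)" for x ys
    by (induction ys) (simp_all add: assms)
  then show ?thesis by (induction xs) simp_all
qed

text \<open>Multiplication by a positive \<open>k\<close> keeps the nonzero rows and their order,
  while for \<open>k = 0\<close> all rows would vanish.\<close>

lemma sorted_rows_scale:
  assumes "0 < k"
  shows "sorted_rows (scale_comp k \<alpha>) = map (\<lambda>(len, lab). (k * len, lab)) (sorted_rows \<alpha>)"
proof -
  have "filter (\<lambda>(len, lab). len \<noteq> 0) (map (\<lambda>(len, lab). (k * len, lab)) xs) =
      map (\<lambda>(len, lab). (k * len, lab)) (filter (\<lambda>(len, lab). len \<noteq> 0) xs)" for xs :: "(nat \<times> nat) list"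
    using assms by (induction xs) auto
  then show ?thesis
    unfolding sorted_rows_def scale_comp_def zip_map1 length_map
    using assms by (simp only:) (rule sort_key_map, auto)
qed

lemma
  assumes "0 < k"
  shows shape_of_scale: "shape_of (scale_comp k \<alpha>) = map ((*) k) (shape_of \<alpha>)"
    and basement_of_scale: "basement_of (scale_comp k \<alpha>) = basement_of \<alpha>"
  using assms by (simp_all add: shape_of_def basement_of_def sorted_rows_scale case_prod_beta')

theorem theorem18:
  fixes \<alpha> :: "nat list"
  shows "satisfies_linear_recurrence (\<lambda>k. key_poly (scale_comp k \<alpha>)) 1
           (\<Prod>m \<in> weight_monom (length \<alpha>) (shape_of \<alpha>) `
                   {T. key_tableau (basement_of \<alpha>) (shape_of \<alpha>) T \<and>
                       equal_height_columns_agree (shape_of \<alpha>) T}.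
              [:- m, 1:])"
proof (rule recurrence_if_spanned)
  let ?b = "basement_of \<alpha>" and ?l = "shape_of \<alpha>"
  let ?M = "weight_monom (length \<alpha>) ?l ` {T. key_tableau ?b ?l T \<and> equal_height_columns_agree ?l T}"
  let ?bs = "shape_blocks ?l (length ?l)"
  show "finite ?M"
    by (rule finite_imageI, rule finite_subset[OF _ finite_key_tableaux]) blast
  have "key_poly (scale_comp (Suc k) \<alpha>) = column_sum (block_heights (Suc k) ?bs) ?b" for k
    by (simp add: key_poly_column_sum shape_of_scale basement_of_scale column_heights_def
        block_heights_scale[unfolded One_nat_def] del: mult_Suc)
  then have "spanned (power_seq ` to_fract ` block_monoms ?bs ?b)
      (\<lambda>k. to_fract (key_poly (scale_comp (Suc k) \<alpha>)))"
    using spanned_column_sum[of ?bs ?b] by simp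
  \<comment> \<open>A larger set of roots only enlarges the span, so the inclusion is
    enough.\<close>
  moreover have "block_monoms ?bs ?b \<subseteq> ?M"
    by (rule key_shape.block_monoms_subset[OF key_shape_of]) (use basement_of_wf in auto)
  ultimately show "spanned (power_seq ` to_fract ` ?M) (\<lambda>k. to_fract (key_poly (scale_comp (Suc k) \<alpha>)))"
    by (elim spanned_mono) (intro image_mono)
qed

end
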